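(* Let $a>0$ and $b,w\in\mathbb R$ be constants such that $C:=\frac{a+b-w}{a}>0$. For $n\ge1$ define $V_n:\{0,\dots,n\}\to\mathbb R$ by $V_n(0)=\frac an+b$ and $$V_n(r)=b+\frac rn\left(a\sum_{j=r}^{n-1}\frac1j+w-b\right),\qquad 1\le r\le n,$$ and let $\Delta_n(r)=V_n(r)-V_n(r-1)$ for $1\le r\le n$. Put $\ell=\mathrm e^{-C}$ and $D_n(r)=\frac{n^2}{a}\Delta_n(r)$. Then: 1. for every $n$ the sequence $\{V_n(r)\}_{r=0}^n$ is unimodal; 2. the largest maximizer $r_n^{\mathrm{opt}}$ of $V_n$ satisfies $r_n^{\mathrm{opt}}/n\to\ell$ as $n\to\infty$; 3. uniformly for bounded $u$ such that $\ell n+u$ is an integer in $\{1,\dots,n\}$, $$D_n(\ell n+u)=-\frac1\ell\left(u-\frac{1-\ell}{2}\right)+O(n^{-1}).$$ In particular, the local expansion holds with $A=-1/\ell<0$ and $c=\frac{1-\ell}2\in(0,1)$.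
   Context: Empty sums are zero. A finite sequence $\{V(r)\}_{r=0}^n$ is unimodal if there exist $0\le \alpha\le \beta\le n$ with $V(0)\le\cdots\le V(\alpha)=\cdots=V(\beta)\ge\cdots\ge V(n)$. "Uniformly for bounded $u$" means: for each $M>0$ there are $K,n_0$ such that the error is at most $K/n$ for all $n\ge n_0$ and all $u$ with $|u|\le M$ and $\ell n+u\in\{1,\dots,n\}$ an integer. Model: $n$ candidates arrive in uniformly random order; the rule with threshold $r$ rejects the first $r$ and accepts the first subsequent record (candidate better than all previous ones); accepting a record at step $k$ has conditional expected payoff $a\frac kn+b$ and no selection has payoff $w$; $V_n(r)$ is the resulting expected payoff. The classical secretary problem is $a=1,b=w=0$ ($C=1$); the problem with interview cost $\kappa\in[0,1)$ is $a=1-\kappa,b=0,w=-\kappa$ ($C=1/(1-\kappa)$); the win–lose–or–draw problem with reward $\alpha$ and penalties $\beta,\gamma$ is $a=\alpha+\beta$, $b=-\beta$, $w=-\gamma$ ($C=(\alpha+\gamma)/(\alpha+\beta)$). *)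

theory Defs
  imports Complex_Main
begin

definition payoff :: "real \<Rightarrow> real \<Rightarrow> real \<Rightarrow> nat \<Rightarrow> nat \<Rightarrow> real" where
  "payoff a b w n r =
     (if r = 0 then a / real n + b
      else b + real r / real n * (a * (\<Sum>j = r..<n. 1 / real j) + w - b))"

(* Only meaningful for r >= 1: the natural-number subtraction truncates at r = 0. *)
definition payoff_diff :: "real \<Rightarrow> real \<Rightarrow> real \<Rightarrow> nat \<Rightarrow> nat \<Rightarrow> real" where
  "payoff_diff a b w n r = payoff a b w n r - payoff a b w n (r - 1)"

definition scaled_diff :: "real \<Rightarrow> real \<Rightarrow> real \<Rightarrow> nat \<Rightarrow> nat \<Rightarrow> real" where
  "scaled_diff a b w n r = (real n)\<^sup>2 / a * payoff_diff a b w n r"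

definition unimodal :: "nat \<Rightarrow> (nat \<Rightarrow> real) \<Rightarrow> bool" where
  "unimodal n V \<longleftrightarrow>
     (\<exists>\<alpha> \<beta>. \<alpha> \<le> \<beta> \<and> \<beta> \<le> n \<and>
        (\<forall>r\<in>{0..<\<alpha>}. V r \<le> V (Suc r)) \<and>
        (\<forall>r\<in>{\<alpha>..<\<beta>}. V r = V (Suc r)) \<and>
        (\<forall>r\<in>{\<beta>..<n}. V r \<ge> V (Suc r)))"

definition largest_maximizer :: "nat \<Rightarrow> (nat \<Rightarrow> real) \<Rightarrow> nat" where
  "largest_maximizer n V = Max {r \<in> {0..n}. \<forall>s\<in>{0..n}. V s \<le> V r}"

(* D n (l * n + u) = f u + O(1/n), uniformly for bounded u such that l * n + u is an
   integer in {1..n}; that integer is the index r. *)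
definition uniform_expansion ::
    "(nat \<Rightarrow> nat \<Rightarrow> real) \<Rightarrow> real \<Rightarrow> (real \<Rightarrow> real) \<Rightarrow> bool" where
  "uniform_expansion D l f \<longleftrightarrow>
     (\<forall>M>0. \<exists>K::real. \<exists>n0::nat. \<forall>n\<ge>n0. \<forall>u::real. \<forall>r\<in>{1..n}.
        \<bar>u\<bar> \<le> M \<longrightarrow> l * real n + u = real r \<longrightarrow> \<bar>D n r - f u\<bar> \<le> K / real n)"

end

theory Submission
  imports Defs "HOL-Analysis.Harmonic_Numbers"
begin

text \<open>
  The boundary value \<open>V\<^sub>n(0)\<close> is exactly what makes
  \<open>\<Delta>\<^sub>n(r) = (a/n) (S r - C)\<close> with \<open>S r = (\<Sum>j = r..<n. 1/j)\<close> hold down to \<open>r = 1\<close>.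
  Since \<open>S\<close> is decreasing and \<open>S n = 0 < C\<close>, the differences change sign once, and the largest
  maximizer is the largest \<open>m\<close> with \<open>S m \<ge> C\<close>. Comparing \<open>S\<close> with logarithms locates
  \<open>m\<close> within distance \<open>1\<close> of \<open>l n\<close>, and the trapezoidal estimate
  \<open>S r = ln (n/r) + (1/r - 1/n)/2 + O(1/r\<^sup>2)\<close> gives the local expansion.
\<close>

section \<open>Logarithmic estimates for sums of reciprocals\<close>

text \<open>By convexity of \<open>1/t\<close>, the integral over \<open>[x, x+1]\<close> lies
  between the midpoint value \<open>2/(2x+1)\<close> and the trapezoid value. The gap between these
  two is bounded by a difference of consecutive values of \<open>1/(8 t^2)\<close>, so that it
  telescopes on summation.\<close>

lemma reciprocal_trapezoid_bounds:
  fixes x :: real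
  assumes "x > 0"
  shows "ln (x + 1) - ln x \<le> (1 / x + 1 / (x + 1)) / 2"
    and "(1 / x + 1 / (x + 1)) / 2 \<le> ln (x + 1) - ln x + (1 / x\<^sup>2 - 1 / (x + 1)\<^sup>2) / 8"
proof -
  show "ln (x + 1) - ln x \<le> (1 / x + 1 / (x + 1)) / 2"
    using ln_inverse_approx_le[of x 1] assms by (simp add: inverse_eq_divide)
  have "(1 / x + 1 / (x + 1)) / 2 - 2 / (2 * x + 1) = 1 / (2 * (x * (x + 1)) * (2 * x + 1))"
    using assms by (simp add: divide_simps add_eq_0_iff) (simp add: algebra_simps)
  also have "\<dots> \<le> (2 * x + 1) / (8 * (x * (x + 1))\<^sup>2)"
  proof -
    have "8 * (x * (x + 1))\<^sup>2 \<le> 2 * (x * (x + 1)) * ((2 * x + 1) * (2 * x + 1))"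
    proof -
      \<comment> \<open>The whole estimate rests on \<open>4x(x+1) <= (2x+1)^2\<close>, whose two
        sides differ by 1.\<close>
      have "2 * (x * (x + 1)) * (4 * (x * (x + 1))) \<le> 2 * (x * (x + 1)) * ((2 * x + 1) * (2 * x + 1))"
        using assms by (intro mult_left_mono) (simp_all add: algebra_simps)
      thus ?thesis by (simp add: power2_eq_square algebra_simps)
    qed
    thus ?thesis using assms by (simp add: divide_simps mult_ac)
  qed
  also have "\<dots> = (1 / x\<^sup>2 - 1 / (x + 1)\<^sup>2) / 8"
  proof -
    have "1 / x\<^sup>2 - 1 / (x + 1)\<^sup>2 = ((x + 1)\<^sup>2 - x\<^sup>2) / (x * (x + 1))\<^sup>2"
      using assms by (simp add: diff_frac_eq power_mult_distrib)
    also have "(x + 1)\<^sup>2 - x\<^sup>2 = 2 * x + 1" by (simp add: power2_eq_square algebra_simps)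
    finally show ?thesis by simp
  qed
  finally have "(1 / x + 1 / (x + 1)) / 2 - 2 / (2 * x + 1) \<le> (1 / x\<^sup>2 - 1 / (x + 1)\<^sup>2) / 8" .
  moreover have "2 / (2 * x + 1) \<le> ln (x + 1) - ln x"
    using ln_inverse_approx_ge[of x "x + 1"] assms by (simp add: add_ac)
  ultimately show "(1 / x + 1 / (x + 1)) / 2 \<le> ln (x + 1) - ln x + (1 / x\<^sup>2 - 1 / (x + 1)\<^sup>2) / 8"
    by linarith
qed

text \<open>Each term \<open>1/j\<close> is its trapezoid value plus
  \<open>(1/j - 1/(j+1))/2\<close>; the latter pieces telescope to the half-difference of the
  endpoints, and every trapezoid dominates the integral.\<close>

lemma sum_reciprocal_ge:
  assumes "1 \<le> r" "r \<le> n"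
  shows "ln (real n / real r) + (1 / real r - 1 / real n) / 2 \<le> (\<Sum>j = r..<n. 1 / real j)"
  using assms(2)
proof (induction n rule: dec_induct)
  case base
  then show ?case using assms(1) by simp
next
  case (step n)
  have n: "real n > 0" using step assms(1) by simp
  have "ln (real (Suc n) / real r) = ln (real n / real r) + (ln (real n + 1) - ln (real n))"
    using n assms(1) by (simp add: ln_div del: of_nat_Suc)
  moreover have "(\<Sum>j = r..<Suc n. 1 / real j) = (\<Sum>j = r..<n. 1 / real j) + 1 / real n"
    using step by simp
  moreover have Suc: "real (Suc n) = real n + 1" by simp
  ultimately show ?case
    using step.IH reciprocal_trapezoid_bounds(1)[OF n] unfolding Suc by argo
qed

text \<open>Same induction, now with the telescoping bound on the trapezoid error. With the lower
  bound, this pins the sum down to \<open>O(1/r^2)\<close>.\<close>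

lemma sum_reciprocal_le:
  assumes "1 \<le> r" "r \<le> n"
  shows "(\<Sum>j = r..<n. 1 / real j) \<le>
    ln (real n / real r) + (1 / real r - 1 / real n) / 2 + (1 / (real r)\<^sup>2 - 1 / (real n)\<^sup>2) / 8"
  using assms(2)
proof (induction n rule: dec_induct)
  case base
  then show ?case using assms(1) by simp
next
  case (step n)
  have n: "real n > 0" using step assms(1) by simp
  have "ln (real (Suc n) / real r) = ln (real n / real r) + (ln (real n + 1) - ln (real n))"
    using n assms(1) by (simp add: ln_div del: of_nat_Suc)
  moreover have "(\<Sum>j = r..<Suc n. 1 / real j) = (\<Sum>j = r..<n. 1 / real j) + 1 / real n"
    using step by simp
  moreover have Suc: "real (Suc n) = real n + 1" by simp
  ultimately show ?case
    using step.IH reciprocal_trapezoid_bounds(2)[OF n] unfolding Suc by argo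
qed

text \<open>Here the terms are right endpoints, so each is at most the integral of
  \<open>1/t\<close> over its interval and no correction term is needed.\<close>

lemma sum_reciprocal_le_ln:
  assumes "1 \<le> r" "r \<le> n"
  shows "(\<Sum>j = Suc r..<Suc n. 1 / real j) \<le> ln (real n / real r)"
  using assms(2)
proof (induction n rule: dec_induct)
  case base
  then show ?case using assms(1) by simp
next
  case (step n)
  have n: "real n > 0" using step assms(1) by simp
  have "ln (real n / real (Suc n)) \<le> real n / real (Suc n) - 1"
    using n by (intro ln_le_minus_one) simp
  also have "\<dots> = - (1 / real (Suc n))" by (simp add: field_simps)
  finally show ?case using step n assms(1) by (simp add: ln_div)
qed

lemma sum_reciprocal_antimono:
  "r \<le> s \<Longrightarrow> (\<Sum>j = s..<n. 1 / real j) \<le> (\<Sum>j = r..<n. 1 / real j)"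
  by (rule sum_mono2) auto

section \<open>Differences of the payoff and its shape\<close>

lemma payoff_diff_eq:
  assumes "a \<noteq> 0" "1 \<le> r" "r \<le> n"
  shows "payoff_diff a b w n r = a / real n * ((\<Sum>j = r..<n. 1 / real j) - (a + b - w) / a)"
proof (cases "r = 1")
  case True
  then show ?thesis
    using assms by (simp add: payoff_diff_def payoff_def field_simps)
next
  case False
  define q where "q = r - 1"
  have q: "r = Suc q" "q \<ge> 1" "q < n" using False assms by (auto simp: q_def)
  \<comment> \<open>Multiplied by \<open>a q/n\<close>, the split-off term \<open>1/q\<close>
    contributes exactly \<open>a/n\<close>, the source of the summand \<open>a\<close> in
    \<open>a + b - w\<close>.\<close>
  have "(\<Sum>j = q..<n. 1 / real j) = 1 / real q + (\<Sum>j = Suc q..<n. 1 / real j)"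
    by (rule sum.atLeast_Suc_lessThan) (use q in auto)
  then show ?thesis
    using assms q by (simp add: payoff_diff_def payoff_def field_simps)
qed

lemma payoff_le_payoff_Suc_iff:
  assumes "a > 0" "r < n"
  shows "payoff a b w n r \<le> payoff a b w n (Suc r) \<longleftrightarrow>
      (a + b - w) / a \<le> (\<Sum>j = Suc r..<n. 1 / real j)"
proof -
  have "payoff a b w n (Suc r) - payoff a b w n r =
      a / real n * ((\<Sum>j = Suc r..<n. 1 / real j) - (a + b - w) / a)"
    using payoff_diff_eq[of a "Suc r" n b w] assms by (simp add: payoff_diff_def)
  moreover have "a / real n > 0" using assms by simp
  ultimately show ?thesis
    by (metis diff_ge_0_iff_ge zero_le_mult_iff not_less less_le_not_le)
qed

text \<open>The threshold sums decrease, so the increments change sign once, at \<open>m\<close>.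
  Ascent before \<open>m\<close> is weak and descent after it strict, which makes \<open>m\<close>
  the largest maximizer. If the sum from 1 is already below the threshold then \<open>m = 0\<close>,
  hence the disjunction.\<close>

lemma payoff_shape:
  assumes "a > 0" "(a + b - w) / a > 0" "n \<ge> 1"
  obtains m where "m < n"
    and "m = 0 \<or> (a + b - w) / a \<le> (\<Sum>j = m..<n. 1 / real j)"
    and "(\<Sum>j = Suc m..<n. 1 / real j) < (a + b - w) / a"
    and "\<And>r. r < m \<Longrightarrow> payoff a b w n r \<le> payoff a b w n (Suc r)"
    and "\<And>r. m \<le> r \<Longrightarrow> r < n \<Longrightarrow> payoff a b w n (Suc r) < payoff a b w n r"
proof -
  define C where "C = (a + b - w) / a"
  define S where "S r = (\<Sum>j = r..<n. 1 / real j)" for r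
  have anti: "r \<le> s \<Longrightarrow> S s \<le> S r" for r s
    unfolding S_def by (rule sum_reciprocal_antimono)
  define m where "m = (LEAST m. S (Suc m) < C)"
  \<comment> \<open>For the candidate \<open>n - 1\<close> the sum is empty, so \<open>C > 0\<close>
    is the claim.\<close>
  have "S (Suc (n - 1)) < C" using assms by (simp add: S_def C_def)
  then have m: "S (Suc m) < C" and "m \<le> n - 1"
    unfolding m_def by (rule LeastI, rule Least_le)
  have below: "C \<le> S (Suc r)" if "r < m" for r
    using not_less_Least[of r "\<lambda>m. S (Suc m) < C"] that by (simp add: m_def)
  show thesis
  proof (rule that[of m])
    show "m < n" using \<open>m \<le> n - 1\<close> assms(3) by simp
    show "m = 0 \<or> (a + b - w) / a \<le> (\<Sum>j = m..<n. 1 / real j)"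
      using below[of "m - 1"] unfolding S_def C_def by (cases m) auto
    show "(\<Sum>j = Suc m..<n. 1 / real j) < (a + b - w) / a"
      using m by (simp add: S_def C_def)
    show "payoff a b w n r \<le> payoff a b w n (Suc r)" if "r < m" for r
      using payoff_le_payoff_Suc_iff[of a r n b w] below[OF that] assms(1) that \<open>m < n\<close>
      by (simp add: S_def C_def)
    show "payoff a b w n (Suc r) < payoff a b w n r" if "m \<le> r" "r < n" for r
      using payoff_le_payoff_Suc_iff[of a r n b w] anti[of "Suc m" "Suc r"] m assms(1) that
      by (simp add: S_def C_def not_le [symmetric])
  qed
qed

section \<open>Unimodality and the location of the largest maximizer\<close>

lemma largest_maximizer_eqI:
  assumes "m \<le> n"
    and inc: "\<And>r. r < m \<Longrightarrow> V r \<le> V (Suc r)"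
    and dec: "\<And>r. m \<le> r \<Longrightarrow> r < n \<Longrightarrow> V (Suc r) < V r"
  shows "largest_maximizer n V = m"
proof -
  have up: "V s \<le> V m" if "s \<le> m" for s
    using that by (induction s rule: inc_induct) (use inc in \<open>auto intro: order_trans\<close>)
  have down: "s \<le> n \<longrightarrow> V s < V m" if "Suc m \<le> s" for s
    using that
  proof (induction s rule: dec_induct)
    case base
    then show ?case using dec[of m] by simp
  next
    case (step s)
    then show ?case using dec[of s] by fastforce
  qed
  show ?thesis unfolding largest_maximizer_def
  proof (rule Max_eqI)
    show "m \<in> {r \<in> {0..n}. \<forall>s\<in>{0..n}. V s \<le> V r}"
      using up down assms(1) by (auto simp: not_less_eq_eq intro: less_imp_le)
        (metis less_imp_le not_less_eq_eq)
    show "y \<le> m" if "y \<in> {r \<in> {0..n}. \<forall>s\<in>{0..n}. V s \<le> V r}" for y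
      using that down[of y] assms(1) by (metis (no_types, lifting) atLeastAtMost_iff le0
          mem_Collect_eq not_less not_less_eq_eq)
  qed simp
qed

lemma payoff_unimodal:
  assumes "a > 0" "(a + b - w) / a > 0" "n \<ge> 1"
  shows "unimodal n (payoff a b w n)"
proof -
  obtain m where "m < n"
    and "\<And>r. r < m \<Longrightarrow> payoff a b w n r \<le> payoff a b w n (Suc r)"
    and "\<And>r. m \<le> r \<Longrightarrow> r < n \<Longrightarrow> payoff a b w n (Suc r) < payoff a b w n r"
    using payoff_shape[OF assms] by metis
  \<comment> \<open>Both witnesses are \<open>m\<close>: the plateau is a single index, and ties to
    its left count as weak ascent.\<close>
  then show ?thesis
    unfolding unimodal_def by (intro exI[of _ m]) (auto intro: less_imp_le)
qed

text \<open>Failure of the threshold inequality at \<open>m + 1\<close> bounds \<open>m\<close> from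
  below, its validity at \<open>m\<close> bounds \<open>m\<close> from above. Dividing by
  \<open>n\<close> gives the limit with rate \<open>1/n\<close>.\<close>

lemma largest_maximizer_payoff_bounds:
  assumes "a > 0" "(a + b - w) / a > 0" "n \<ge> 1"
  shows "\<bar>real (largest_maximizer n (payoff a b w n)) - exp (- ((a + b - w) / a)) * real n\<bar> \<le> 1"
proof -
  define C where "C = (a + b - w) / a"
  obtain m where m: "m < n" "m = 0 \<or> C \<le> (\<Sum>j = m..<n. 1 / real j)"
      "(\<Sum>j = Suc m..<n. 1 / real j) < C"
    and "\<And>r. r < m \<Longrightarrow> payoff a b w n r \<le> payoff a b w n (Suc r)"
    and "\<And>r. m \<le> r \<Longrightarrow> r < n \<Longrightarrow> payoff a b w n (Suc r) < payoff a b w n r"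
    using payoff_shape[OF assms] unfolding C_def by metis
  then have eq: "largest_maximizer n (payoff a b w n) = m"
    by (intro largest_maximizer_eqI) auto
  have "exp (- C) * real n \<le> real m + 1"
  proof -
    define d where "d = (1 / real (Suc m) - 1 / real n) / 2"
    have "1 / real n \<le> 1 / real (Suc m)" using m(1) by (intro divide_left_mono) auto
    then have "0 \<le> d" by (simp add: d_def)
    moreover have "ln (real n / real (Suc m)) + d \<le> (\<Sum>j = Suc m..<n. 1 / real j)"
      unfolding d_def using m(1) by (intro sum_reciprocal_ge) auto
    ultimately have "ln (real n / real (Suc m)) < C"
      using m(3) by argo
    then have "exp (ln (real n / real (Suc m))) < exp C" by simp
    then have "real n / real (Suc m) < exp C" using m(1) by simp
    then show ?thesis by (simp add: exp_minus field_simps)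
  qed
  moreover have "real m - 1 \<le> exp (- C) * real n"
  \<comment> \<open>Small \<open>m\<close> is split off because the logarithmic bound below divides
    by \<open>m - 1\<close>; it also covers \<open>m = 0\<close>.\<close>
  proof (cases "m \<le> 1")
    case True
    then show ?thesis by (smt (verit) exp_ge_zero mult_nonneg_nonneg of_nat_0_le_iff of_nat_1 of_nat_mono)
  next
    case False
    \<comment> \<open>Both limits are shifted to fit the right-endpoint bound.\<close>
    have "C \<le> (\<Sum>j = Suc (m - 1)..<Suc (n - 1). 1 / real j)"
      using m False by simp
    also have "\<dots> \<le> ln (real (n - 1) / real (m - 1))"
      using m False by (intro sum_reciprocal_le_ln) auto
    finally have "exp C \<le> real (n - 1) / real (m - 1)"
      using m(1) False by (subst (asm) ln_ge_iff) auto
    then have "real (m - 1) * exp C \<le> real (n - 1)"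
      using False by (simp add: field_simps)
    then show ?thesis using False m(1) by (simp add: exp_minus field_simps of_nat_diff)
  qed
  ultimately show ?thesis by (simp add: eq C_def abs_le_iff)
qed

lemma largest_maximizer_payoff_tendsto:
  assumes "a > 0" "(a + b - w) / a > 0"
  shows "(\<lambda>n. real (largest_maximizer n (payoff a b w n)) / real n)
    \<longlonglongrightarrow> exp (- ((a + b - w) / a))"
proof (rule LIM_zero_cancel, rule Lim_null_comparison)
  define l where "l = exp (- ((a + b - w) / a))"
  show "\<forall>\<^sub>F n in sequentially.
      norm (real (largest_maximizer n (payoff a b w n)) / real n - exp (- ((a + b - w) / a))) \<le> 1 / real n"
    using eventually_ge_at_top[of 1]
  proof eventually_elim
    case (elim n)
    have "\<bar>real (largest_maximizer n (payoff a b w n)) / real n - l\<bar> =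
        \<bar>real (largest_maximizer n (payoff a b w n)) - l * real n\<bar> / real n"
      using elim by (subst (2) abs_of_nat[symmetric], subst abs_divide[symmetric])
        (simp add: diff_divide_distrib)
    also have "\<dots> \<le> 1 / real n"
      using largest_maximizer_payoff_bounds[OF assms elim] by (intro divide_right_mono) (auto simp: l_def)
    finally show ?case by (simp add: l_def)
  qed
  show "(\<lambda>n. 1 / real n) \<longlonglongrightarrow> 0" by (rule lim_1_over_n)
qed

section \<open>The local expansion near \<open>l n\<close>\<close>

text \<open>The scaled difference is \<open>n (S r - C)\<close> with \<open>-C = ln l\<close>.
  Writing \<open>r = l n (1 + x)\<close> cancels the large logarithms and leaves three errors: the
  trapezoid error, \<open>x - ln (1 + x)\<close>, and the replacement of \<open>1/r\<close> by
  \<open>1/(l n)\<close>. They contribute \<open>1/2\<close>, \<open>2 M^2\<close> and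
  \<open>M\<close> to the constant.\<close>

lemma scaled_diff_expansion:
  fixes a b w u M l :: real
  assumes a: "a > 0" and l: "l = exp (- ((a + b - w) / a))" and M: "M > 0"
    and r: "1 \<le> r" "r \<le> n" and u: "\<bar>u\<bar> \<le> M" "l * real n + u = real r"
    and large: "2 * M \<le> l * real n"
  shows "\<bar>scaled_diff a b w n r - - (1 / l) * (u - (1 - l) / 2)\<bar> \<le> (2 * M\<^sup>2 + M + 1 / 2) / l\<^sup>2 / real n"
proof -
  have l0: "l > 0" and n0: "real n > 0" and r0: "real r > 0" using l r by auto
  define N R where "N = real n" and "R = real r"
  note pos = l0 n0[folded N_def] r0[folded R_def]
  have R: "R = l * N + u" using u by (simp add: N_def R_def)
  \<comment> \<open>The assumption \<open>large\<close> keeps \<open>r\<close> at least half of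
    \<open>l n\<close>, so powers of \<open>1/r\<close> can be traded for powers of
    \<open>1/(l n)\<close>; it also gives \<open>|x| <= 1/2\<close> for the logarithm bound.\<close>
  have half: "l * N \<le> 2 * R" using u large by (simp add: N_def R_def)
  define x where "x = u / (l * N)"
  have x: "\<bar>x\<bar> \<le> 1 / 2" "R / (l * N) = 1 + x"
    using u large pos by (simp_all add: x_def N_def R field_simps)
  define e where "e = (\<Sum>j = r..<n. 1 / real j) - (ln (N / R) + (1 / R - 1 / N) / 2)"
  have "0 \<le> e"
    using sum_reciprocal_ge[OF r] by (simp add: e_def N_def R_def)
  have "e \<le> (1 / R\<^sup>2 - 1 / N\<^sup>2) / 8"
    using sum_reciprocal_le[OF r] unfolding e_def N_def R_def by linarith
  also have "\<dots> \<le> 1 / (8 * R\<^sup>2)" by simp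
  also have "\<dots> \<le> 1 / (2 * (l * N)\<^sup>2)"
  proof -
    have "(l * N)\<^sup>2 \<le> (2 * R)\<^sup>2" using half pos by (intro power_mono) auto
    then show ?thesis using pos by (intro divide_left_mono) (auto simp: power_mult_distrib mult_ac)
  qed
  finally have e_le: "e \<le> 1 / (2 * (l * N)\<^sup>2)" .
  have e: "\<bar>N * e\<bar> \<le> (1 / 2) / l\<^sup>2 / N"
  proof -
    have "N * e \<le> N * (1 / (2 * (l * N)\<^sup>2))" using e_le pos by (intro mult_left_mono) auto
    also have "\<dots> = (1 / 2) / l\<^sup>2 / N" using pos by (simp add: power2_eq_square)
    finally show ?thesis using \<open>0 \<le> e\<close> pos by (simp add: abs_mult)
  qed
  have lnx: "\<bar>N * (x - ln (1 + x))\<bar> \<le> 2 * M\<^sup>2 / l\<^sup>2 / N"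
  proof -
    have "\<bar>N * (x - ln (1 + x))\<bar> = N * \<bar>ln (1 + x) - x\<bar>"
      using pos by (simp add: abs_mult abs_minus_commute)
    also have "\<dots> \<le> N * (2 * x\<^sup>2)"
      using abs_ln_one_plus_x_minus_x_bound[OF x(1)] pos by (intro mult_left_mono) auto
    also have "\<dots> = 2 * u\<^sup>2 / l\<^sup>2 / N" using pos by (simp add: x_def power2_eq_square)
    also have "\<dots> \<le> 2 * M\<^sup>2 / l\<^sup>2 / N"
      using u(1) M pos by (intro divide_right_mono mult_left_mono)
        (auto simp: abs_le_square_iff[symmetric])
    finally show ?thesis .
  qed
  have ur: "\<bar>u / (2 * R * l)\<bar> \<le> M / l\<^sup>2 / N"
  proof -
    have "\<bar>u / (2 * R * l)\<bar> = \<bar>u\<bar> / (2 * R * l)" using pos by (simp add: abs_mult)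
    also have "\<dots> \<le> M / (l * N * l)"
      using u(1) half pos M by (intro frac_le mult_right_mono) auto
    finally show ?thesis by (simp add: power2_eq_square mult_ac)
  qed
  have "(a + b - w) / a = - ln l" using l by simp
  then have "scaled_diff a b w n r = N * (e + ln (N / R) + (1 / R - 1 / N) / 2 + ln l)"
    using payoff_diff_eq[of a r n b w] a r n0
    by (simp add: scaled_diff_def e_def N_def power2_eq_square)
  also have "ln l = - ln (1 + x) - ln (N / R)"
    using pos by (simp add: x(2)[symmetric] ln_div ln_mult)
  also have "N * (e + ln (N / R) + (1 / R - 1 / N) / 2 + (- ln (1 + x) - ln (N / R))) =
      N * e - N * ln (1 + x) + N * ((1 / R - 1 / N) / 2)"
    by argo
  \<comment> \<open>The linear term comes from \<open>N x = u/l\<close>; the shift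
    \<open>(1 - l)/2\<close> comes from the trapezoid correction, whose value at
    \<open>R = l N\<close> is \<open>(1/l - 1)/2\<close>.\<close>
  also have "\<dots> - - (1 / l) * (u - (1 - l) / 2) = N * e + N * (x - ln (1 + x)) - u / (2 * R * l)"
  proof -
    have 1: "N * x = u / l" using pos by (simp add: x_def)
    have "N * ((1 / R - 1 / N) / 2) - (1 / l - 1) / 2 = (N * l - R) / (2 * R * l)"
      using pos by (simp add: field_simps)
    also have "\<dots> = - (u / (2 * R * l))" by (simp add: R)
    finally have 2: "N * ((1 / R - 1 / N) / 2) = (1 / l - 1) / 2 - u / (2 * R * l)" by argo
    show ?thesis unfolding 2 using pos
      by (simp add: 1 right_diff_distrib) (simp add: field_simps)
  qed
  finally have eq: "scaled_diff a b w n r - - (1 / l) * (u - (1 - l) / 2) =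
      N * e + N * (x - ln (1 + x)) - u / (2 * R * l)" .
  have "\<bar>p + q - s\<bar> \<le> \<bar>p\<bar> + \<bar>q\<bar> + \<bar>s\<bar>" for p q s :: real by linarith
  then have "\<bar>scaled_diff a b w n r - - (1 / l) * (u - (1 - l) / 2)\<bar> \<le>
      \<bar>N * e\<bar> + \<bar>N * (x - ln (1 + x))\<bar> + \<bar>u / (2 * R * l)\<bar>"
    by (simp only: eq)
  also have "\<dots> \<le> (1 / 2) / l\<^sup>2 / N + 2 * M\<^sup>2 / l\<^sup>2 / N + M / l\<^sup>2 / N"
    using e lnx ur by linarith
  also have "\<dots> = (2 * M\<^sup>2 + M + 1 / 2) / l\<^sup>2 / N" by (simp add: add_divide_distrib)
  finally show ?thesis by (simp add: N_def)
qed

lemma scaled_diff_uniform_expansion: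
  fixes a b w l :: real
  assumes a: "a > 0" and l: "l = exp (- ((a + b - w) / a))"
  shows "uniform_expansion (scaled_diff a b w) l (\<lambda>u. - (1 / l) * (u - (1 - l) / 2))"
  unfolding uniform_expansion_def
proof (intro allI impI)
  fix M :: real
  assume M: "M > 0"
  have "l > 0" using l by simp
  \<comment> \<open>This fixes the threshold \<open>n0\<close>, which depends only on
    \<open>M\<close> and \<open>l\<close>, as does the constant \<open>K\<close>.\<close>
  have large: "2 * M \<le> l * real n" if "n \<ge> nat \<lceil>2 * M / l\<rceil>" for n
  proof -
    have "2 * M / l \<le> real n" using that by linarith
    then show ?thesis using \<open>l > 0\<close> by (simp add: field_simps)
  qed
  show "\<exists>K n0. \<forall>n\<ge>n0. \<forall>u. \<forall>r\<in>{1..n}. \<bar>u\<bar> \<le> M \<longrightarrow> l * real n + u = real r \<longrightarrow>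
      \<bar>scaled_diff a b w n r - - (1 / l) * (u - (1 - l) / 2)\<bar> \<le> K / real n"
    using scaled_diff_expansion[OF a l M] large
    by (intro exI[of _ "(2 * M\<^sup>2 + M + 1 / 2) / l\<^sup>2"] exI[of _ "nat \<lceil>2 * M / l\<rceil>"]) simp
qed

theorem mainTheorem5:
  fixes a b w C l :: real
  assumes "a > 0"
    and "C = (a + b - w) / a"
    and "C > 0"
    and "l = exp (- C)"
  shows "(\<forall>n\<ge>1. unimodal n (payoff a b w n)) \<and>
    (\<lambda>n. real (largest_maximizer n (payoff a b w n)) / real n) \<longlonglongrightarrow> l \<and>
    uniform_expansion (scaled_diff a b w) l (\<lambda>u. - (1 / l) * (u - (1 - l) / 2)) \<and>
    (\<exists>A c. A = - 1 / l \<and> A < 0 \<and> c = (1 - l) / 2 \<and> c \<in> {0<..<1} \<and>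
       uniform_expansion (scaled_diff a b w) l (\<lambda>u. A * (u - c)))"
proof (intro conjI)
  have l: "l = exp (- ((a + b - w) / a))" and C: "(a + b - w) / a > 0"
    using assms by simp_all
  show "\<forall>n\<ge>1. unimodal n (payoff a b w n)"
    using payoff_unimodal[OF assms(1) C] by blast
  show "(\<lambda>n. real (largest_maximizer n (payoff a b w n)) / real n) \<longlonglongrightarrow> l"
    using largest_maximizer_payoff_tendsto[OF assms(1) C] by (simp only: l)
  show expansion: "uniform_expansion (scaled_diff a b w) l (\<lambda>u. - (1 / l) * (u - (1 - l) / 2))"
    by (rule scaled_diff_uniform_expansion[OF assms(1) l])
  \<comment> \<open>Positivity of \<open>C\<close> enters as \<open>l < 1\<close>, which puts
    \<open>c\<close> in the open unit interval.\<close>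
  have "0 < l" "l < 1" using assms by simp_all
  with expansion show "\<exists>A c. A = - 1 / l \<and> A < 0 \<and> c = (1 - l) / 2 \<and> c \<in> {0<..<1} \<and>
       uniform_expansion (scaled_diff a b w) l (\<lambda>u. A * (u - c))"
    by (intro exI[of _ "- 1 / l"] exI[of _ "(1 - l) / 2"]) simp
qed

end
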